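(* Let $d_1,\dots,d_g$ be positive integers. Suppose that $g\ge 3$, that there is an integer $d$ with $d_i+d_{g+1-i}=d$ for all $i=1,\dots,g$, and that $\gcd\{d_1,\dots,d_g\}=1$. Then the polynomial $$f(t):=t^d-\sum_{i=1}^g t^{d_i}+1$$ has a unique (complex) root of maximal modulus and that root is real. *)

theory Defs
  imports "HOL-Computational_Algebra.Computational_Algebra" Complex_Main
begin

definition palin_poly :: "nat \<Rightarrow> (nat \<Rightarrow> nat) \<Rightarrow> nat \<Rightarrow> complex poly" where
  "palin_poly g ds d = monom 1 d - (\<Sum>i=1..g. monom 1 (ds i)) + 1"

text \<open>Roots are compared as elements of the complex numbers, not counted with multiplicity.\<close>

definition max_modulus_root :: "complex poly \<Rightarrow> complex \<Rightarrow> bool" where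
  "max_modulus_root p z \<longleftrightarrow>
     poly p z = 0 \<and> (\<forall>w. poly p w = 0 \<longrightarrow> cmod w \<le> cmod z)"

end

theory Submission
  imports Defs
begin

text \<open>
  Put \<open>a = d\<^sub>1\<close> and \<open>b = d\<^sub>g\<close>, so that \<open>a + b = d\<close> and
  \<open>f(t) = (t\<^sup>a - 1)(t\<^sup>b - 1) - \<Sum> t\<^sup>e\<close>, where \<open>e\<close> runs over the remaining exponents, all at most \<open>d\<close>.
  On \<open>(1, \<infinity>)\<close> the quotient \<open>f(t) / t\<^sup>d\<close> is strictly increasing, and \<open>f(1) < 0\<close>, so \<open>f\<close> has
  exactly one real root \<open>\<rho> > 1\<close>.
  If \<open>f(z) = 0\<close> and \<open>R = \<bar>z\<bar> > 1\<close>, then the triangle inequality gives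
  \<open>(R\<^sup>a - 1)(R\<^sup>b - 1) \<le> \<Sum> R\<^sup>e\<close>, that is \<open>f(R) \<le> 0\<close>, hence \<open>R \<le> \<rho>\<close>. If \<open>R = \<rho>\<close>, all
  these estimates are equalities, so \<open>z\<close> and \<open>R\<close> have the same \<open>n\<close>-th power for every exponent
  \<open>n\<close> among the \<open>d\<^sub>i\<close>; as these are coprime, \<open>z = R\<close>.
\<close>

lemma power_gcd_eq_1:
  fixes u :: "'a::field"
  assumes "u ^ m = 1" "u ^ n = 1"
  shows "u ^ gcd m n = 1"
proof (cases "m = 0")
  case False
  \<comment> \<open>Bezout in a subtraction-free form, so only natural exponents occur.\<close>
  then obtain x y where "m * x = n * y + gcd m n"
    using bezout_nat by blast
  then have "u ^ (m * x) = u ^ (n * y) * u ^ gcd m n"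
    by (simp add: power_add)
  then show ?thesis
    using assms by (simp add: power_mult)
qed (use assms in simp)

lemma power_Gcd_eq_1:
  fixes u :: "'a::field"
  assumes "finite A" "\<And>n. n \<in> A \<Longrightarrow> u ^ n = 1"
  shows "u ^ Gcd A = 1"
  using assms by (induction A rule: finite_induct) (auto intro: power_gcd_eq_1)

lemma complex_eq_of_Re_ge_cmod:
  assumes "Re w \<ge> cmod w"
  shows "w = of_real (cmod w)"
proof -
  have "Re w = cmod w"
    using assms complex_Re_le_cmod[of w] by simp
  moreover from this have "Im w = 0"
    using cmod_power2[of w] by simp
  ultimately show ?thesis
    by (simp add: complex_eq_iff)
qed

text \<open>Equality case of the reverse triangle inequality: squaring leaves only a comparison of
  \<open>Re w\<close> with \<open>cmod w\<close>.\<close>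

lemma complex_eq_of_cmod_minus_1_le:
  assumes "cmod (w - 1) \<le> cmod w - 1"
  shows "w = of_real (cmod w)"
proof (rule complex_eq_of_Re_ge_cmod)
  have "(cmod (w - 1))\<^sup>2 \<le> (cmod w - 1)\<^sup>2"
    using assms by (intro power_mono) auto
  moreover have "(cmod (w - 1))\<^sup>2 = (cmod w)\<^sup>2 - 2 * Re w + 1"
    unfolding cmod_power2 by (simp add: power2_eq_square algebra_simps)
  ultimately show "Re w \<ge> cmod w"
    by (simp add: power2_eq_square algebra_simps)
qed

text \<open>Equality case of the triangle inequality: the nonnegative gaps
  \<open>cmod (w j) - Re (w j)\<close> add up to 0, so each vanishes.\<close>

lemma complex_eq_of_sum_eq_sum_cmod:
  assumes "finite I" "(\<Sum>i\<in>I. w i) = of_real (\<Sum>i\<in>I. cmod (w i))" "i \<in> I"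
  shows "w i = of_real (cmod (w i))"
proof (rule complex_eq_of_Re_ge_cmod)
  have "(\<Sum>j\<in>I. cmod (w j) - Re (w j)) = 0"
    using arg_cong[OF assms(2), of Re] by (simp add: sum_subtractf)
  then have "cmod (w i) - Re (w i) = 0"
    using assms(1,3) complex_Re_le_cmod by (subst (asm) sum_nonneg_eq_0_iff) auto
  then show "Re (w i) \<ge> cmod (w i)"
    by simp
qed

text \<open>Scaling \<open>x\<close> by \<open>c = y / x > 1\<close> multiplies the sum by at most
  \<open>c ^ (a + b)\<close>, whereas \<open>y ^ n - 1 = c ^ n * x ^ n - 1\<close> exceeds
  \<open>c ^ n * (x ^ n - 1)\<close>, so the product grows by more.\<close>

lemma factored_strict_mono:
  fixes x y :: real
  assumes "1 < x" "x < y" "a > 0" "b > 0" "\<And>i. i \<in> I \<Longrightarrow> e i \<le> a + b"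
    and "(\<Sum>i\<in>I. x ^ e i) \<le> (x ^ a - 1) * (x ^ b - 1)"
  shows "(\<Sum>i\<in>I. y ^ e i) < (y ^ a - 1) * (y ^ b - 1)"
proof -
  define c where "c = y / x"
  have c: "c > 1" and y: "y = c * x"
    using assms by (auto simp: c_def)
  have pow: "0 < c ^ n * (x ^ n - 1) \<and> c ^ n * (x ^ n - 1) < y ^ n - 1" if "n > 0" for n
    using one_less_power[OF c that] one_less_power[OF assms(1) that]
    by (simp add: y power_mult_distrib algebra_simps)
  have "(\<Sum>i\<in>I. y ^ e i) \<le> (\<Sum>i\<in>I. c ^ (a + b) * x ^ e i)"
    using assms c by (intro sum_mono) (simp add: y power_mult_distrib)
  also have "\<dots> = c ^ (a + b) * (\<Sum>i\<in>I. x ^ e i)"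
    by (simp add: sum_distrib_left)
  also have "\<dots> \<le> c ^ (a + b) * ((x ^ a - 1) * (x ^ b - 1))"
    using assms(6) c by (intro mult_left_mono) auto
  also have "\<dots> = (c ^ a * (x ^ a - 1)) * (c ^ b * (x ^ b - 1))"
    by (simp add: power_add)
  also have "\<dots> < (y ^ a - 1) * (y ^ b - 1)"
    using pow[OF assms(3)] pow[OF assms(4)] by (intro mult_strict_mono) auto
  finally show ?thesis .
qed

lemma power_minus_1_le_cmod: "cmod z ^ n - 1 \<le> cmod (z ^ n - 1)"
  using norm_triangle_ineq2[of "z ^ n" 1] by (simp add: norm_power)

lemma factored_root_cmod:
  assumes "cmod z > 1" "(z ^ a - 1) * (z ^ b - 1) = (\<Sum>i\<in>I. z ^ e i)"
  shows "(cmod z ^ a - 1) * (cmod z ^ b - 1) \<le> (\<Sum>i\<in>I. cmod z ^ e i)"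
proof -
  have "(cmod z ^ a - 1) * (cmod z ^ b - 1) \<le> cmod (z ^ a - 1) * cmod (z ^ b - 1)"
    using assms(1) by (intro mult_mono power_minus_1_le_cmod) auto
  also have "\<dots> = cmod (\<Sum>i\<in>I. z ^ e i)"
    by (simp add: norm_mult[symmetric] assms(2))
  also have "\<dots> \<le> (\<Sum>i\<in>I. cmod z ^ e i)"
    using norm_sum[of "\<lambda>i. z ^ e i" I] by (simp add: norm_power)
  finally show ?thesis .
qed

lemma factored_root_powers:
  fixes z :: complex
  defines "R \<equiv> cmod z"
  assumes "R > 1" "a > 0" "b > 0" "finite I"
    and root: "(z ^ a - 1) * (z ^ b - 1) = (\<Sum>i\<in>I. z ^ e i)"
    and root_R: "(R ^ a - 1) * (R ^ b - 1) = (\<Sum>i\<in>I. R ^ e i)"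
  shows "z ^ a = of_real R ^ a" "z ^ b = of_real R ^ b"
    and "\<And>i. i \<in> I \<Longrightarrow> z ^ e i = of_real R ^ e i"
proof -
  have pos: "R ^ a - 1 > 0" "R ^ b - 1 > 0"
    using assms one_less_power by auto
  have "cmod (z ^ a - 1) * cmod (z ^ b - 1) \<le> (\<Sum>i\<in>I. R ^ e i)"
    using norm_sum[of "\<lambda>i. z ^ e i" I]
    by (simp add: norm_mult[symmetric] root R_def norm_power)
  then have le: "cmod (z ^ a - 1) * cmod (z ^ b - 1) \<le> (R ^ a - 1) * (R ^ b - 1)"
    by (simp add: root_R)
  have ge: "R ^ n - 1 \<le> cmod (z ^ n - 1)" for n
    unfolding R_def by (rule power_minus_1_le_cmod)
  \<comment> \<open>Both factors have positive lower bounds whose product is already the upper bound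
    \<open>le\<close>; hence neither factor can exceed its own bound.\<close>
  have "cmod (z ^ a - 1) \<le> R ^ a - 1"
  proof (rule ccontr)
    assume "\<not> ?thesis"
    then have "(R ^ a - 1) * (R ^ b - 1) < cmod (z ^ a - 1) * cmod (z ^ b - 1)"
      using pos ge[of b] by (intro mult_less_le_imp_less) auto
    with le show False by simp
  qed
  then show za: "z ^ a = of_real R ^ a"
    using complex_eq_of_cmod_minus_1_le[of "z ^ a"] by (simp add: R_def norm_power)
  have "cmod (z ^ b - 1) \<le> R ^ b - 1"
  proof (rule ccontr)
    assume "\<not> ?thesis"
    then have "(R ^ a - 1) * (R ^ b - 1) < cmod (z ^ a - 1) * cmod (z ^ b - 1)"
      using pos ge[of a] by (intro mult_le_less_imp_less) auto
    with le show False by simp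
  qed
  then show zb: "z ^ b = of_real R ^ b"
    using complex_eq_of_cmod_minus_1_le[of "z ^ b"] by (simp add: R_def norm_power)
  have "(\<Sum>i\<in>I. z ^ e i) = of_real ((R ^ a - 1) * (R ^ b - 1))"
    by (simp add: root[symmetric] za zb)
  then have "(\<Sum>i\<in>I. z ^ e i) = of_real (\<Sum>i\<in>I. cmod (z ^ e i))"
    unfolding root_R by (simp add: R_def norm_power)
  from complex_eq_of_sum_eq_sum_cmod[OF \<open>finite I\<close> this]
  show "z ^ e i = of_real R ^ e i" if "i \<in> I" for i
    using that by (simp add: R_def norm_power)
qed

text \<open>Stated over a commutative ring to serve both the real root and the complex ones.\<close>

lemma palindromic_factored:
  fixes x :: "'a::comm_ring_1" and ds :: "nat \<Rightarrow> nat"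
  assumes "g \<ge> 2" "ds 1 + ds g = d"
  shows "x ^ d - (\<Sum>i=1..g. x ^ ds i) + 1 =
    (x ^ ds 1 - 1) * (x ^ ds g - 1) - (\<Sum>i\<in>{2..<g}. x ^ ds i)"
proof -
  have "{1..g} = insert 1 (insert g {2..<g})"
    using assms(1) by auto
  then have "(\<Sum>i=1..g. x ^ ds i) = x ^ ds 1 + (x ^ ds g + (\<Sum>i\<in>{2..<g}. x ^ ds i))"
    using assms(1) by simp
  then show ?thesis
    by (simp add: assms(2)[symmetric] power_add algebra_simps)
qed

lemma palindromic_real_root:
  fixes ds :: "nat \<Rightarrow> nat"
  assumes "g \<ge> 3" "\<And>i. i \<in> {1..g} \<Longrightarrow> ds i < d"
  obtains \<rho> :: real where "\<rho> > 1" "\<rho> ^ d - (\<Sum>i=1..g. \<rho> ^ ds i) + 1 = 0"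
proof -
  define f where "f = (\<lambda>x::real. x ^ d - (\<Sum>i=1..g. x ^ ds i) + 1)"
  have f1: "f 1 < 0"
    using assms(1) by (simp add: f_def)
  have "d > 0"
    using assms(2)[of 1] assms(1) by auto
  \<comment> \<open>The point \<open>g\<close> works as right end for the intermediate value
    theorem: \<open>g\<close> terms of size at most \<open>g ^ (d - 1)\<close> sum to at most
    \<open>g ^ d\<close>.\<close>
  have "(\<Sum>i=1..g. real g ^ ds i) \<le> (\<Sum>i=1..g. real g ^ (d - 1))"
  proof (intro sum_mono power_increasing)
    show "ds i \<le> d - 1" if "i \<in> {1..g}" for i
      using assms(2)[OF that] by linarith
  qed (use assms in auto)
  also have "\<dots> = real g ^ d"
    using \<open>d > 0\<close> by (simp add: power_eq_if)
  finally have "f (real g) \<ge> 0"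
    by (simp add: f_def)
  moreover have "continuous_on {1..real g} f"
    unfolding f_def by (intro continuous_intros)
  ultimately obtain \<rho> where "1 \<le> \<rho>" "f \<rho> = 0"
    using IVT'[of f 1 0 "real g"] f1 assms(1) by auto
  moreover from this f1 have "\<rho> \<noteq> 1"
    by auto
  ultimately show ?thesis
    using that[of \<rho>] by (simp add: f_def)
qed

theorem proposition1p2:
  fixes g d :: nat and ds :: "nat \<Rightarrow> nat"
  assumes "g \<ge> 3"
    and "\<forall>i\<in>{1..g}. ds i > 0"
    and "\<forall>i\<in>{1..g}. ds i + ds (g + 1 - i) = d"
    and "Gcd (ds ` {1..g}) = 1"
  shows "(\<exists>!z. max_modulus_root (palin_poly g ds d) z) \<and>
         (\<forall>z. max_modulus_root (palin_poly g ds d) z \<longrightarrow> z \<in> \<real>)"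
proof -
  let ?p = "palin_poly g ds d" and ?a = "ds 1" and ?b = "ds g" and ?I = "{2..<g}"
  have lt: "ds i < d" if "i \<in> {1..g}" for i
  proof -
    \<comment> \<open>The mirrored exponent is positive, which makes the inequality strict.\<close>
    have "g + 1 - i \<in> {1..g}"
      using that by auto
    then have "ds (g + 1 - i) > 0"
      using assms(2) by blast
    moreover have "ds i + ds (g + 1 - i) = d"
      using assms(3) that by blast
    ultimately show ?thesis
      by linarith
  qed
  have pos: "?a > 0" "?b > 0"
    using assms(1,2) by auto
  have ab: "?a + ?b = d"
    using bspec[OF assms(3), of 1] assms(1) by simp
  have I_le: "ds i \<le> ?a + ?b" if "i \<in> ?I" for i
    using lt[of i] that unfolding ab by simp
  have poly_eq: "poly ?p z = z ^ d - (\<Sum>i=1..g. z ^ ds i) + 1" for z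
    by (simp add: palin_poly_def poly_sum poly_monom)
  obtain \<rho> :: real where \<rho>: "\<rho> > 1" "\<rho> ^ d - (\<Sum>i=1..g. \<rho> ^ ds i) + 1 = 0"
    using palindromic_real_root[of g ds d] lt assms(1) by blast
  have "poly ?p (of_real \<rho>) = of_real (\<rho> ^ d - (\<Sum>i=1..g. \<rho> ^ ds i) + 1)"
    by (simp add: poly_eq)
  then have root_\<rho>: "poly ?p (of_real \<rho>) = 0"
    unfolding \<rho>(2) by simp
  have fac_\<rho>: "(\<rho> ^ ?a - 1) * (\<rho> ^ ?b - 1) = (\<Sum>i\<in>?I. \<rho> ^ ds i)"
    using \<rho>(2) palindromic_factored[of g ds d \<rho>] ab assms(1) by simp
  have fac: "(z ^ ?a - 1) * (z ^ ?b - 1) = (\<Sum>i\<in>?I. z ^ ds i)" if "poly ?p z = 0" for z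
    using that palindromic_factored[of g ds d z] ab assms(1) by (simp add: poly_eq)
  have le: "cmod z \<le> \<rho>" if "poly ?p z = 0" for z
  proof (rule ccontr)
    assume "\<not> ?thesis"
    then have z: "\<rho> < cmod z"
      by simp
    \<comment> \<open>Monotonicity from \<rho> makes the product at \<open>cmod z\<close> strictly
      larger than the sum, against the triangle inequality at the root \<open>z\<close>.\<close>
    show False
      using factored_strict_mono[OF \<rho>(1) z pos I_le eq_refl[OF fac_\<rho>[symmetric]]]
        factored_root_cmod[OF _ fac[OF that]] z \<rho>(1) by simp
  qed
  have eq: "z = of_real \<rho>" if z: "poly ?p z = 0" "cmod z = \<rho>" for z
  proof -
    note powers = factored_root_powers[of z, unfolded z(2), OF \<rho>(1) pos _ fac[OF z(1)] fac_\<rho>]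
    have "z ^ ds i = of_real \<rho> ^ ds i" if i: "i \<in> {1..g}" for i
    proof -
      consider "i = 1" | "i = g" | "i \<in> ?I"
        using i by force
      then show ?thesis
        using powers by cases simp_all
    qed
    \<comment> \<open>Dividing by \<rho> turns equal powers into powers equal to 1, which pass to
      the gcd.\<close>
    then have "(z / of_real \<rho>) ^ n = 1" if "n \<in> ds ` {1..g}" for n
      using that \<rho>(1) by (auto simp: power_divide)
    then have "(z / of_real \<rho>) ^ Gcd (ds ` {1..g}) = 1"
      by (intro power_Gcd_eq_1) auto
    then show ?thesis
      using assms(4) \<rho>(1) by simp
  qed
  have "max_modulus_root ?p z \<longleftrightarrow> z = of_real \<rho>" for z
  proof
    assume "max_modulus_root ?p z"
    then have "poly ?p z = 0" "\<rho> \<le> cmod z"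
      using root_\<rho> \<rho>(1) by (auto simp: max_modulus_root_def dest!: spec[of _ "of_real \<rho>"])
    then show "z = of_real \<rho>"
      using le eq by force
  next
    assume "z = of_real \<rho>"
    then show "max_modulus_root ?p z"
      using root_\<rho> le \<rho>(1) by (simp add: max_modulus_root_def)
  qed
  then show ?thesis
    by simp
qed

end
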